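(* Let $d\geq 1$, let $\Lambda\subset\mathbb R^d$ and let $(T_\lambda)_{\lambda\in\Lambda}$ be a family of bounded linear operators acting on the infinite-dimensional separable Banach space $X$. Assume that there exist $\alpha>0$, $v\in X$, $\delta>0$ and $C>0$ such that, for all $\lambda,\mu\in\Lambda$, all $n\in\mathbb N$ and all $u\in X$ satisfying $$\|T_\lambda^nu-v\|<\delta\quad\text{and}\quad\|T_\mu^nu-v\|<\delta,$$ one has $$\|T_\lambda^nu-T_\mu^nu\|\ge Cn^\alpha\|\lambda-\mu\|.$$ If $\bigcap_{\lambda\in\Lambda}HC(T_\lambda)\neq\varnothing$, then $\dim_{\mathcal H}(\Lambda)\le\frac1\alpha$.
   Context: $\mathbb R^d$ is endowed with the sup-norm. A vector $x\in X$ is hypercyclic for $T$ if its orbit $\{T^nx:\ n\ge0\}$ is dense in $X$; $HC(T)$ is the set of hypercyclic vectors of $T$. $\dim_{\mathcal H}$ denotes Hausdorff dimension. *)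

theory Defs
  imports "HOL-Analysis.Analysis"
begin

definition infinite_dimensional :: "'a::real_vector set \<Rightarrow> bool" where
  "infinite_dimensional S \<longleftrightarrow> \<not> (\<exists>B. finite B \<and> S \<subseteq> span B)"

definition hypercyclic_vectors :: "('a::topological_space \<Rightarrow> 'a) \<Rightarrow> 'a set" where
  "hypercyclic_vectors T = {x. closure (range (\<lambda>n. (T ^^ n) x)) = UNIV}"

text \<open>
  Hausdorff measure and dimension are defined relative to an explicit distance function
  \<open>d\<close>, so that they can be used with the sup-norm distance on \<open>real ^ 'n\<close> instead of the
  Euclidean one carried by that type.
\<close>

definition diam_wrt :: "('a \<Rightarrow> 'a \<Rightarrow> real) \<Rightarrow> 'a set \<Rightarrow> ennreal" where
  "diam_wrt d U = (SUP x\<in>U. SUP y\<in>U. ennreal (d x y))"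

text \<open>
  The term \<open>(diam U)^s\<close> with the usual conventions that \<open>(diam U)^0 = 1\<close> for nonempty \<open>U\<close>
  and that the empty set contributes \<open>0\<close> (whereas \<open>0 powr 0 = 0\<close> for \<open>powr\<close>). It is only
  used for sets of finite diameter, so that \<open>enn2real\<close> loses nothing.
\<close>
definition diam_powr :: "('a \<Rightarrow> 'a \<Rightarrow> real) \<Rightarrow> real \<Rightarrow> 'a set \<Rightarrow> ennreal" where
  "diam_powr d s U =
     (if U = {} then 0 else if s = 0 then 1 else ennreal (enn2real (diam_wrt d U) powr s))"

definition hausdorff_premeasure ::
    "('a \<Rightarrow> 'a \<Rightarrow> real) \<Rightarrow> real \<Rightarrow> real \<Rightarrow> 'a set \<Rightarrow> ennreal" where
  "hausdorff_premeasure d s r A =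
     (INF U\<in>{U :: nat \<Rightarrow> 'a set. A \<subseteq> (\<Union>i. U i) \<and> (\<forall>i. diam_wrt d (U i) \<le> ennreal r)}.
        \<Sum>i. diam_powr d s (U i))"

definition hausdorff_measure :: "('a \<Rightarrow> 'a \<Rightarrow> real) \<Rightarrow> real \<Rightarrow> 'a set \<Rightarrow> ennreal" where
  "hausdorff_measure d s A = (SUP r\<in>{0<..}. hausdorff_premeasure d s r A)"

definition hausdorff_dim :: "('a \<Rightarrow> 'a \<Rightarrow> real) \<Rightarrow> 'a set \<Rightarrow> ennreal" where
  "hausdorff_dim d A = (INF s\<in>{s. 0 \<le> s \<and> hausdorff_measure d s A = 0}. ennreal s)"

text \<open>On \<open>real ^ 'n\<close>, \<open>infnorm\<close> is the maximum of the absolute values of the coordinates.\<close>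
definition sup_dist :: "real ^ 'n \<Rightarrow> real ^ 'n \<Rightarrow> real" where
  "sup_dist x y = infnorm (x - y)"

end

theory Submission
  imports Defs
begin

text \<open>
  Let \<open>u\<close> be a common hypercyclic vector and let \<open>E\<^sub>n\<close> be the set of parameters \<open>l\<close> for which
  \<open>T\<^sub>l\<^sup>n u\<close> is \<open>\<delta>\<close>-close to \<open>v\<close>. Two orbits that are both close to \<open>v\<close> at time \<open>n\<close> are
  \<open>2 \<delta>\<close>-close to each other, so the separation hypothesis gives \<open>diam E\<^sub>n \<le> 2 \<delta> / (C n\<^sup>\<alpha>)\<close>.
  Every orbit visits the ball infinitely often, hence each tail of \<open>(E\<^sub>n)\<close> covers \<open>\<Lambda>\<close>, and
  \<open>\<Sum> (diam E\<^sub>n)\<^sup>s\<close> converges as soon as \<open>s \<alpha> > 1\<close>.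
\<close>

lemma diam_powr_le:
  assumes "diam_wrt d U \<le> ennreal b" and "0 \<le> b" and "0 < s"
  shows "diam_powr d s U \<le> ennreal (b powr s)"
proof -
  have "enn2real (diam_wrt d U) \<le> b"
    using enn2real_leI assms by blast
  then show ?thesis
    using assms(3) by (auto simp: diam_powr_def intro!: ennreal_leI powr_mono2)
qed

text \<open>A Borel-Cantelli argument: each tail of \<open>E\<close> is itself an admissible cover
  once its diameters are small, and its cost is bounded by a tail of a convergent series.\<close>

lemma hausdorff_measure_limsup_eq_0:
  assumes s: "0 < s"
    and b: "\<And>n. 0 \<le> b n" "\<And>n. diam_wrt d (E n) \<le> ennreal (b n)"
    and sm: "summable (\<lambda>n. b n powr s)"
    and cov: "\<And>N. A \<subseteq> (\<Union>n\<in>{N..}. E n)"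
  shows "hausdorff_measure d s A = 0"
proof -
  have "hausdorff_premeasure d s r A \<le> 0" if r: "0 < r" for r
  proof (rule ennreal_le_epsilon)
    fix e :: real assume e: "0 < e"
    obtain M where M: "\<And>n. n \<ge> M \<Longrightarrow> norm (\<Sum>i. b (i + n) powr s) < e"
      using suminf_exist_split[OF e sm] by blast
    have "(\<lambda>n. b n powr s) \<longlonglongrightarrow> 0"
      using sm by (rule summable_LIMSEQ_zero)
    then have "\<forall>\<^sub>F n in sequentially. b n powr s < r powr s"
      by (rule order_tendstoD) (use r in simp)
    then obtain K where K: "\<And>n. n \<ge> K \<Longrightarrow> b n powr s < r powr s"
      by (auto simp: eventually_sequentially)
    \<comment> \<open>Beyond \<open>M\<close> the tail sum is below \<open>e\<close>; beyond
      \<open>K\<close> each single set is fine enough for the scale \<open>r\<close>.\<close>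
    define N where "N = max M K"
    define U where "U i = E (i + N)" for i
    \<comment> \<open>Otherwise monotonicity of \<open>powr\<close> would give
      \<open>r powr s \<le> b n powr s\<close>.\<close>
    have "b n < r" if "n \<ge> K" for n
      using K[OF that] powr_mono2[of s r "b n"] s r by linarith
    then have "b (i + N) \<le> r" for i
      by (simp add: N_def less_imp_le)
    then have diam: "diam_wrt d (U i) \<le> ennreal r" for i
      unfolding U_def using b(2) by (blast intro: ennreal_leI order_trans)
    have sub: "A \<subseteq> (\<Union>i. U i)"
    proof
      fix x assume "x \<in> A"
      then obtain n where "n \<ge> N" "x \<in> E n"
        using cov[of N] by auto
      then have "x \<in> U (n - N)"
        by (simp add: U_def)
      then show "x \<in> (\<Union>i. U i)"
        by blast
    qed
    have "hausdorff_premeasure d s r A \<le> (\<Sum>i. diam_powr d s (U i))"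
      unfolding hausdorff_premeasure_def using diam sub by (intro INF_lower) auto
    also have "\<dots> \<le> (\<Sum>i. ennreal (b (i + N) powr s))"
      unfolding U_def using b s by (intro suminf_le diam_powr_le) auto
    also have "\<dots> = ennreal (\<Sum>i. b (i + N) powr s)"
      using sm by (intro suminf_ennreal2 summable_ignore_initial_segment) auto
    also have "\<dots> \<le> ennreal e"
      using M[of N] by (intro ennreal_leI) (auto simp: N_def)
    finally show "hausdorff_premeasure d s r A \<le> 0 + ennreal e"
      by simp
  qed
  then have "hausdorff_measure d s A \<le> 0"
    unfolding hausdorff_measure_def by (intro SUP_least) simp
  then show ?thesis
    by simp
qed

text \<open>The value \<open>t\<close> itself is left out because at the critical exponent the
  series of the main proof is harmonic; an arbitrarily small slack \<open>e\<close> recovers the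
  bound.\<close>

lemma hausdorff_dim_leI:
  assumes "0 \<le> t" and "\<And>s. t < s \<Longrightarrow> hausdorff_measure d s A = 0"
  shows "hausdorff_dim d A \<le> ennreal t"
proof (rule ennreal_le_epsilon)
  fix e :: real assume e: "0 < e"
  have "hausdorff_dim d A \<le> ennreal (t + e)"
    unfolding hausdorff_dim_def using assms e by (intro INF_lower) auto
  then show "hausdorff_dim d A \<le> ennreal t + ennreal e"
    using assms(1) e by simp
qed

lemma infinite_ball_if_nontrivial:
  fixes v w :: "'a::real_normed_vector"
  assumes "w \<noteq> 0" and "0 < e"
  shows "infinite (ball v e)"
proof -
  define f where "f t = v + t *\<^sub>R w" for t
  have "f ` {0<..<e / norm w} \<subseteq> ball v e"
    using assms by (auto simp: f_def dist_norm field_simps)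
  moreover have "inj_on f {0<..<e / norm w}"
    using assms by (auto simp: f_def inj_on_def)
  moreover have "infinite {0<..<e / norm w}"
    using assms by (simp add: infinite_Ioo)
  ultimately show ?thesis
    by (meson finite_imageD finite_subset)
qed

text \<open>Deleting the finitely many orbit points before time \<open>N\<close> from the ball
  leaves a nonempty open set, which the dense orbit must meet, necessarily at time \<open>N\<close>
  or later.\<close>

lemma hypercyclic_visits_late:
  fixes T :: "'a::real_normed_vector \<Rightarrow> 'a"
  assumes "infinite_dimensional (UNIV :: 'a set)"
    and "u \<in> hypercyclic_vectors T" and "0 < e"
  shows "\<exists>n\<ge>N. norm ((T ^^ n) u - v) < e"
proof -
  obtain w :: 'a where "w \<noteq> 0"
    \<comment> \<open>If zero were the only vector, the span of the empty set would be the whole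
      space.\<close>
    using assms(1) unfolding infinite_dimensional_def
    by (metis finite.emptyI span_empty subsetI singletonI)
  then have "infinite (ball v e)"
    using assms(3) by (rule infinite_ball_if_nontrivial)
  define F where "F = (\<lambda>n. (T ^^ n) u) ` {..<N}"
  have "finite F"
    by (simp add: F_def)
  have "ball v e - F \<noteq> {}"
    using \<open>finite F\<close> \<open>infinite (ball v e)\<close> by (metis Diff_eq_empty_iff finite_subset)
  moreover have "open (ball v e - F)"
    using \<open>finite F\<close> by (simp add: finite_imp_closed open_Diff)
  ultimately have "range (\<lambda>n. (T ^^ n) u) \<inter> (ball v e - F) \<noteq> {}"
    using assms(2) open_Int_closure_eq_empty[of "ball v e - F" "range (\<lambda>n. (T ^^ n) u)"]
    by (auto simp: hypercyclic_vectors_def)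
  then obtain n where "(T ^^ n) u \<in> ball v e" "(T ^^ n) u \<notin> F"
    by auto
  then have "\<not> n < N" "norm ((T ^^ n) u - v) < e"
    by (auto simp: F_def dist_norm norm_minus_commute)
  then show ?thesis
    using not_less by blast
qed

theorem theorem1p2:
  fixes \<Lambda> :: "(real ^ 'd) set"
    and T :: "real ^ 'd \<Rightarrow> 'x::banach \<Rightarrow> 'x"
    and \<alpha> \<delta> C :: real
    and v :: 'x
  assumes "separable_space (euclidean :: 'x topology)"
    and "infinite_dimensional (UNIV :: 'x set)"
    and "\<And>l. l \<in> \<Lambda> \<Longrightarrow> bounded_linear (T l)"
    and "\<alpha> > 0" and "\<delta> > 0" and "C > 0"
    and "\<And>l m (n::nat) u. \<lbrakk> l \<in> \<Lambda>; m \<in> \<Lambda>;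
            norm ((T l ^^ n) u - v) < \<delta>; norm ((T m ^^ n) u - v) < \<delta> \<rbrakk>
          \<Longrightarrow> norm ((T l ^^ n) u - (T m ^^ n) u) \<ge> C * real n powr \<alpha> * infnorm (l - m)"
    and "(\<Inter>l\<in>\<Lambda>. hypercyclic_vectors (T l)) \<noteq> {}"
  shows "hausdorff_dim sup_dist \<Lambda> \<le> ennreal (1 / \<alpha>)"
proof (rule hausdorff_dim_leI)
  show "0 \<le> 1 / \<alpha>"
    using assms(4) by simp
next
  fix s assume s: "1 / \<alpha> < s"
  moreover have "0 < 1 / \<alpha>"
    using assms(4) by simp
  ultimately have s0: "0 < s"
    by linarith
  obtain u where u: "\<And>l. l \<in> \<Lambda> \<Longrightarrow> u \<in> hypercyclic_vectors (T l)"
    using assms(8) by auto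
  \<comment> \<open>Indexed by \<open>Suc n\<close> because the separation hypothesis says nothing at time \<open>0\<close>.\<close>
  define E where "E n = {l \<in> \<Lambda>. norm ((T l ^^ Suc n) u - v) < \<delta>}" for n
  define b where "b n = 2 * \<delta> / C * real (Suc n) powr - \<alpha>" for n
  show "hausdorff_measure sup_dist s \<Lambda> = 0"
  proof (rule hausdorff_measure_limsup_eq_0[OF s0])
    show "0 \<le> b n" for n
      using assms(5,6) by (simp add: b_def)
    show "diam_wrt sup_dist (E n) \<le> ennreal (b n)" for n
      unfolding diam_wrt_def
    proof (intro SUP_least ennreal_leI)
      fix l m assume lm: "l \<in> E n" "m \<in> E n"
      have "C * real (Suc n) powr \<alpha> * infnorm (l - m)
          \<le> norm ((T l ^^ Suc n) u - (T m ^^ Suc n) u)"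
        using lm by (intro assms(7)) (auto simp: E_def)
      also have "\<dots> \<le> norm ((T l ^^ Suc n) u - v) + norm ((T m ^^ Suc n) u - v)"
        using norm_triangle_ineq4[of "(T l ^^ Suc n) u - v" "(T m ^^ Suc n) u - v"] by simp
      also have "\<dots> \<le> 2 * \<delta>"
        using lm unfolding E_def by simp
      finally have "C * real (Suc n) powr \<alpha> * infnorm (l - m) \<le> 2 * \<delta>" .
      then show "sup_dist l m \<le> b n"
        using assms(6) by (simp add: sup_dist_def b_def powr_minus field_simps del: of_nat_Suc)
    qed
    \<comment> \<open>This is where the bound \<open>1 / \<alpha>\<close> comes from: it is the
      convergence threshold of the p-series with exponent \<open>\<alpha> * s\<close>.\<close>
    have "1 < \<alpha> * s"
      using s assms(4) by (simp add: field_simps)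
    then have "summable (\<lambda>n. real n powr - (\<alpha> * s))"
      by (simp add: summable_real_powr_iff)
    then have "summable (\<lambda>n. (2 * \<delta> / C) powr s * real (Suc n) powr - (\<alpha> * s))"
      by (intro summable_mult) (subst summable_Suc_iff)
    moreover have "b n powr s = (2 * \<delta> / C) powr s * real (Suc n) powr - (\<alpha> * s)" for n
      using assms(5,6) unfolding b_def by (subst powr_mult) (auto simp: powr_powr)
    ultimately show "summable (\<lambda>n. b n powr s)"
      by simp
    show "\<Lambda> \<subseteq> (\<Union>n\<in>{N..}. E n)" for N
    proof
      fix l assume l: "l \<in> \<Lambda>"
      \<comment> \<open>The shift in \<open>E\<close> records a visit at time \<open>n\<close> under
        index \<open>n - 1\<close>, so the visit has to occur at time \<open>Suc N\<close> or
        later.\<close>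
      obtain n where n: "n \<ge> Suc N" "norm ((T l ^^ n) u - v) < \<delta>"
        using hypercyclic_visits_late[OF assms(2) u[OF l] assms(5)] by blast
      then have "l \<in> E (n - 1)" "n - 1 \<ge> N"
        using l by (auto simp: E_def simp del: funpow.simps)
      then show "l \<in> (\<Union>n\<in>{N..}. E n)"
        by blast
    qed
  qed
qed

end
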